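(* Let $0\le r\le n$ be integers and $\mathbb{K}$ a field. The flag matroid $\mathcal{I}(U_{r,n})$ is $\mathbb{K}$-representable if and only if $r\le 1$ or $|\mathbb{K}|\ge n$.
   Context: $U_{r,n}$ denotes the uniform matroid on an $n$-element set $E$ whose independent sets are all subsets of size at most $r$. $\mathcal{I}(U_{r,n})$ is the flag matroid on $E$ whose feasible sets are all independent sets of $U_{r,n}$, i.e. all subsets of $E$ of size at most $r$; equivalently, its sequential representation is $(U_{0,n},U_{1,n},\dots,U_{r,n})$ (the matroids whose bases are the subsets of $E$ of size $0,1,\dots,r$). In general, a flag matroid is a sequence $(M_1,\dots,M_k)$ of matroids on a common ground set with each $M_{i+1}$ a nontrivial lift of $M_i$ (every flat of $M_i$ is a flat of $M_{i+1}$ and $M_{i+1}\neq M_i$); its feasible sets are the bases of all the $M_i$, and $(M_1,\dots,M_k)$ is its sequential representation. For a matrix $A\in\mathbb{K}^{m\times n}$ with columns indexed by $E$, $M(A)$ denotes the matroid on $E$ whose independent sets are the sets of linearly independent columns, and $A_{\le d}$ denotes the submatrix of the first $d$ rows (with $M(A_{\le 0})$ the matroid whose only basis is $\emptyset$). A flag matroid with sequential representation $(M_1,\dots,M_k)$ is $\mathbb{K}$-representable if there exist a matrix $A\in\mathbb{K}^{m\times n}$ and integers $0\le d_1<\dots<d_k=m$ with $M_i=M(A_{\le d_i})$ for all $i$. *)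

theory Defs
  imports "Jordan_Normal_Form.VS_Connect"
begin

record 'a matroid =
  ground :: "'a set"
  indeps :: "'a set set"

definition is_matroid :: "'a matroid \<Rightarrow> bool" where
  "is_matroid M \<longleftrightarrow>
     finite (ground M) \<and> indeps M \<subseteq> Pow (ground M) \<and> {} \<in> indeps M \<and>
     (\<forall>I \<in> indeps M. \<forall>J. J \<subseteq> I \<longrightarrow> J \<in> indeps M) \<and>
     (\<forall>I \<in> indeps M. \<forall>J \<in> indeps M. card J < card I \<longrightarrow>
        (\<exists>e \<in> I - J. insert e J \<in> indeps M))"

definition bases :: "'a matroid \<Rightarrow> 'a set set" where
  "bases M = {B \<in> indeps M. \<forall>I \<in> indeps M. B \<subseteq> I \<longrightarrow> I = B}"

definition matroid_rank :: "'a matroid \<Rightarrow> 'a set \<Rightarrow> nat" where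
  "matroid_rank M X = Max (card ` {I \<in> indeps M. I \<subseteq> X})"

definition flat :: "'a matroid \<Rightarrow> 'a set \<Rightarrow> bool" where
  "flat M F \<longleftrightarrow> F \<subseteq> ground M \<and>
     (\<forall>e \<in> ground M - F. matroid_rank M F < matroid_rank M (insert e F))"

definition nontrivial_lift :: "'a matroid \<Rightarrow> 'a matroid \<Rightarrow> bool" where
  "nontrivial_lift N M \<longleftrightarrow>
     ground N = ground M \<and> (\<forall>F. flat M F \<longrightarrow> flat N F) \<and> N \<noteq> M"

text \<open>A flag matroid is identified with its sequential representation, a list of matroids.\<close>

definition flag_matroid :: "'a set \<Rightarrow> 'a matroid list \<Rightarrow> bool" where
  "flag_matroid E Ms \<longleftrightarrow>
     Ms \<noteq> [] \<and> (\<forall>M \<in> set Ms. is_matroid M \<and> ground M = E) \<and>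
     (\<forall>i. Suc i < length Ms \<longrightarrow> nontrivial_lift (Ms ! Suc i) (Ms ! i))"

definition feasible_sets :: "'a matroid list \<Rightarrow> 'a set set" where
  "feasible_sets Ms = (\<Union>M \<in> set Ms. bases M)"

definition uniform_matroid :: "nat \<Rightarrow> 'a set \<Rightarrow> 'a matroid" where
  "uniform_matroid r E = \<lparr>ground = E, indeps = {I. I \<subseteq> E \<and> card I \<le> r}\<rparr>"

definition uniform_indep_flag :: "nat \<Rightarrow> 'a set \<Rightarrow> 'a matroid list" where
  "uniform_indep_flag r E = map (\<lambda>k. uniform_matroid k E) [0..<Suc r]"

definition first_rows :: "nat \<Rightarrow> 'k mat \<Rightarrow> 'k mat" where
  "first_rows d A = mat d (dim_col A) (\<lambda>(i, j). A $$ (i, j))"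

text \<open>
  Columns are labelled by \<open>E\<close> through a bijection \<open>l\<close> from \<open>E\<close> to the column indices.
  Independence is that of the family of columns, so repeated columns are dependent;
  since \<open>lin_dep\<close> only sees the set of columns, injectivity is required separately.
\<close>

definition column_matroid :: "'a set \<Rightarrow> ('a \<Rightarrow> nat) \<Rightarrow> 'k::field mat \<Rightarrow> 'a matroid" where
  "column_matroid E l A =
     \<lparr>ground = E,
      indeps = {S. S \<subseteq> E \<and> inj_on (\<lambda>e. col A (l e)) S \<and>
        \<not> module.lin_dep class_ring (module_vec TYPE('k) (dim_row A)) ((\<lambda>e. col A (l e)) ` S)}\<rparr>"

definition representable_flag_matroid ::
    "'k::field itself \<Rightarrow> 'a set \<Rightarrow> 'a matroid list \<Rightarrow> bool" where
  "representable_flag_matroid _ E Ms \<longleftrightarrow>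
     flag_matroid E Ms \<and>
     (\<exists>(A :: 'k mat) m l ds.
        A \<in> carrier_mat m (card E) \<and> bij_betw l E {..<card E} \<and>
        length ds = length Ms \<and> sorted_wrt (<) ds \<and> last ds = m \<and>
        (\<forall>i < length Ms. Ms ! i = column_matroid E l (first_rows (ds ! i) A)))"

lemma ground_uniform_matroid [simp]: "ground (uniform_matroid r E) = E"
  and indeps_uniform_matroid [simp]: "indeps (uniform_matroid r E) = {I. I \<subseteq> E \<and> card I \<le> r}"
  by (simp_all add: uniform_matroid_def)

lemma is_matroid_uniform:
  assumes "finite E"
  shows "is_matroid (uniform_matroid r E)"
proof -
  have fin: "finite I" if "I \<subseteq> E" for I
    using that assms by (rule finite_subset)
  have augment: "\<exists>e \<in> I - J. insert e J \<subseteq> E \<and> card (insert e J) \<le> r"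
    if "I \<subseteq> E" "card I \<le> r" "J \<subseteq> E" "card J < card I" for I J
  proof -
    have "\<not> I \<subseteq> J"
      using that fin card_mono[of J I] by auto
    then obtain e where "e \<in> I - J" by blast
    moreover have "card (insert e J) \<le> r"
      using that fin[of J] \<open>e \<in> I - J\<close> by simp
    ultimately show ?thesis using that by blast
  qed
  have "card J \<le> r" if "I \<subseteq> E" "card I \<le> r" "J \<subseteq> I" for I J
    using that fin[of I] card_mono[of I J] by linarith
  then have "\<forall>I \<in> {I. I \<subseteq> E \<and> card I \<le> r}. \<forall>J. J \<subseteq> I \<longrightarrow> J \<in> {I. I \<subseteq> E \<and> card I \<le> r}"
    by blast
  moreover have "\<forall>I \<in> {I. I \<subseteq> E \<and> card I \<le> r}. \<forall>J \<in> {I. I \<subseteq> E \<and> card I \<le> r}. card J < card I \<longrightarrow>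
      (\<exists>e \<in> I - J. insert e J \<in> {I. I \<subseteq> E \<and> card I \<le> r})"
    using augment by (intro ballI impI) (simp only: mem_Collect_eq)
  moreover have "{I. I \<subseteq> E \<and> card I \<le> r} \<subseteq> Pow E" "{} \<in> {I. I \<subseteq> E \<and> card I \<le> r}"
    by auto
  ultimately show ?thesis
    using assms unfolding is_matroid_def ground_uniform_matroid indeps_uniform_matroid
    by (intro conjI)
qed

lemma bases_uniform:
  assumes "finite E" "r \<le> card E"
  shows "bases (uniform_matroid r E) = {B. B \<subseteq> E \<and> card B = r}"
proof -
  have 1: "card B = r"
    if B: "B \<subseteq> E" "card B \<le> r" "\<And>I. I \<subseteq> E \<Longrightarrow> card I \<le> r \<Longrightarrow> B \<subseteq> I \<Longrightarrow> I = B" for B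
  proof (rule ccontr)
    assume "card B \<noteq> r"
    then have lt: "card B < r" using B by simp
    then have "B \<noteq> E" using assms by auto
    then obtain e where e: "e \<in> E - B" using B by blast
    have "card (insert e B) \<le> r"
      using e lt finite_subset[OF B(1) assms(1)] by simp
    then show False using B(3)[of "insert e B"] B(1) e by auto
  qed
  have 2: "I = B" if "B \<subseteq> E" "card B = r" "I \<subseteq> E" "card I \<le> r" "B \<subseteq> I" for B I
    using that card_seteq[of I B] finite_subset[OF _ assms(1)] by auto
  show ?thesis
    unfolding bases_def indeps_uniform_matroid
  proof (intro Collect_cong iffI)
    fix B
    assume "B \<in> {I. I \<subseteq> E \<and> card I \<le> r} \<and> (\<forall>I \<in> {I. I \<subseteq> E \<and> card I \<le> r}. B \<subseteq> I \<longrightarrow> I = B)"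
    then show "B \<subseteq> E \<and> card B = r" using 1[of B] by blast
  next
    fix B
    assume "B \<subseteq> E \<and> card B = r"
    then show "B \<in> {I. I \<subseteq> E \<and> card I \<le> r} \<and> (\<forall>I \<in> {I. I \<subseteq> E \<and> card I \<le> r}. B \<subseteq> I \<longrightarrow> I = B)"
      using 2[of B] by blast
  qed
qed

lemma matroid_rank_uniform:
  assumes "finite E" "X \<subseteq> E"
  shows "matroid_rank (uniform_matroid r E) X = min (card X) r"
proof -
  have fX: "finite X" using assms finite_subset by blast
  let ?S = "{I. I \<subseteq> E \<and> card I \<le> r \<and> I \<subseteq> X}"
  have fS: "finite ?S" by (rule finite_subset[of _ "Pow X"]) (use fX in auto)
  obtain I where "I \<subseteq> X" "card I = min (card X) r"
    using obtain_subset_with_card_n[of "min (card X) r" X] by auto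
  then have mem: "min (card X) r \<in> card ` ?S"
    using assms(2) by (intro image_eqI[of _ _ I]) auto
  have "y \<le> min (card X) r" if "y \<in> card ` ?S" for y
    using that card_mono[OF fX] by auto
  then have "Max (card ` ?S) = min (card X) r"
    by (rule Max_eqI[OF finite_imageI[OF fS] _ mem])
  then show ?thesis by (simp add: matroid_rank_def conj_assoc)
qed

lemma flag_matroid_uniform_indep_flag:
  assumes "finite E" "r \<le> card E"
  shows "flag_matroid E (uniform_indep_flag r E)"
proof -
  have "nontrivial_lift (uniform_matroid (Suc k) E) (uniform_matroid k E)" if "k < r" for k
  proof -
    have flat: "flat (uniform_matroid (Suc k) E) F" if "flat (uniform_matroid k E) F" for F
    proof -
      have F: "F \<subseteq> E" using that by (simp add: flat_def)
      have "finite F" using F assms(1) by (rule finite_subset)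
      have "min (card F) (Suc k) < min (card (insert e F)) (Suc k)" if e: "e \<in> E - F" for e
      proof -
        have "min (card F) k < min (card (insert e F)) k"
          using \<open>flat (uniform_matroid k E) F\<close> F e assms(1)
          by (auto simp: flat_def matroid_rank_uniform)
        then show ?thesis using e \<open>finite F\<close> by auto
      qed
      then show ?thesis
        using F assms(1)
        by (auto simp: flat_def matroid_rank_uniform)
    qed
    obtain I where "I \<subseteq> E" "card I = Suc k"
      using obtain_subset_with_card_n[of "Suc k" E] \<open>k < r\<close> assms by auto
    then have "I \<in> indeps (uniform_matroid (Suc k) E)" "I \<notin> indeps (uniform_matroid k E)"
      by auto
    then have "uniform_matroid (Suc k) E \<noteq> uniform_matroid k E"
      by (intro notI) (simp only:)
    with flat show ?thesis
      by (simp add: nontrivial_lift_def)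
  qed
  moreover have "uniform_indep_flag r E ! i = uniform_matroid i E" if "i \<le> r" for i
    using that by (simp add: uniform_indep_flag_def del: upt_Suc)
  ultimately have "\<forall>i. Suc i < length (uniform_indep_flag r E) \<longrightarrow>
      nontrivial_lift (uniform_indep_flag r E ! Suc i) (uniform_indep_flag r E ! i)"
    by (simp add: uniform_indep_flag_def del: upt_Suc)
  moreover have "is_matroid M \<and> ground M = E" if "M \<in> set (uniform_indep_flag r E)" for M
  proof -
    obtain k where "M = uniform_matroid k E"
      using \<open>M \<in> _\<close> unfolding uniform_indep_flag_def by auto
    then show ?thesis using is_matroid_uniform[OF assms(1)] by simp
  qed
  moreover have "uniform_indep_flag r E \<noteq> []"
    by (simp add: uniform_indep_flag_def)
  ultimately show ?thesis by (simp add: flag_matroid_def)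
qed

lemma feasible_sets_uniform_indep_flag:
  assumes "finite E" "r \<le> card E"
  shows "feasible_sets (uniform_indep_flag r E) = indeps (uniform_matroid r E)"
proof -
  have "feasible_sets (uniform_indep_flag r E) = (\<Union>k \<in> {0..<Suc r}. bases (uniform_matroid k E))"
    by (simp add: feasible_sets_def uniform_indep_flag_def del: upt_Suc)
  also have "\<dots> = (\<Union>k \<in> {0..<Suc r}. {B. B \<subseteq> E \<and> card B = k})"
    using assms by (intro SUP_cong) (auto simp: bases_uniform)
  finally show ?thesis by auto
qed

end

theory Submission
  imports Defs "HOL-Computational_Algebra.Polynomial"
begin

text \<open>
  Sufficiency: take the Vandermonde matrix with rows \<open>x\<^sub>e ^ i\<close>. Its first \<open>k\<close> rows represent
  \<open>U\<^bsub>k,n\<^esub>\<close> when the nodes \<open>x\<^sub>e\<close> are distinct; for \<open>k \<le> 1\<close> the nodes do not matter.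
  Necessity: since the second matroid of the flag is \<open>U\<^bsub>1,n\<^esub>\<close>, there is a row in which no entry
  vanishes, and all columns may be scaled to have entry 1 there. Truncated to the rows representing
  \<open>U\<^bsub>2,n\<^esub>\<close>, the scaled columns are distinct points of the affine line through any two of them,
  and such a line has \<open>|K|\<close> points.
\<close>

section \<open>Independence of indexed families of vectors, including the Vandermonde case\<close>

text \<open>Vectors are coordinate functions on \<open>nat\<close>, so passing to fewer rows only
  changes the bound \<open>d\<close>. Coefficients belong to labels, not to vectors, hence a
  repeated vector already makes the family dependent.\<close>

definition indep_family :: "nat \<Rightarrow> ('a \<Rightarrow> nat \<Rightarrow> 'k::field) \<Rightarrow> 'a set \<Rightarrow> bool" where
  "indep_family d w S \<longleftrightarrow>
     (\<forall>c. (\<forall>i<d. (\<Sum>e\<in>S. c e * w e i) = 0) \<longrightarrow> (\<forall>e\<in>S. c e = 0))"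

lemma indep_family_iff_lin_indpt:
  fixes v :: "'a \<Rightarrow> 'k::field vec"
  assumes finS: "finite S" and car: "v ` S \<subseteq> carrier_vec d"
  shows "inj_on v S \<and> \<not> module.lin_dep class_ring (module_vec TYPE('k) d) (v ` S)
    \<longleftrightarrow> indep_family d (\<lambda>e i. v e $ i) S"
proof -
  interpret vec_space "TYPE('k)" d .
  have lincomb_eq: "lincomb a (v ` S) $ i = (\<Sum>e\<in>S. a (v e) * v e $ i)"
    if "inj_on v S" "i < d" for a i
    using lincomb_index[OF \<open>i < d\<close> car, of a] sum.reindex[OF \<open>inj_on v S\<close>] by simp
  show ?thesis
  proof (intro iffI conjI)
    assume *: "inj_on v S \<and> \<not> lin_dep (v ` S)"
    show "indep_family d (\<lambda>e i. v e $ i) S"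
      unfolding indep_family_def
    proof (intro allI impI ballI)
      fix c e
      assume c: "\<forall>i<d. (\<Sum>e\<in>S. c e * v e $ i) = 0" and e: "e \<in> S"
      \<comment> \<open>Coefficients on labels are carried over to the vectors; injectivity of
        \<open>v\<close> makes this consistent.\<close>
      define a where "a = c \<circ> inv_into S v"
      have a: "a (v f) = c f" if "f \<in> S" for f
        using that * by (simp add: a_def)
      have "lincomb a (v ` S) = 0\<^sub>v d"
      proof (rule eq_vecI)
        show "dim_vec (lincomb a (v ` S)) = dim_vec (0\<^sub>v d)"
          using lincomb_dim[OF _ car] finS by simp
        fix i assume "i < dim_vec (0\<^sub>v d :: 'k vec)"
        then have "i < d" by simp
        then show "lincomb a (v ` S) $ i = 0\<^sub>v d $ i"
          using lincomb_eq[of i a] * c a by (simp cong: sum.cong)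
      qed
      then have "a (v e) = 0"
        using * e finS unfolding lin_dep_def by auto
      then show "c e = 0" using a e by simp
    qed
  next
    assume ind: "indep_family d (\<lambda>e i. v e $ i) S"
    show inj: "inj_on v S"
    proof (rule inj_onI, rule ccontr)
      fix e f assume ef: "e \<in> S" "f \<in> S" "v e = v f" "e \<noteq> f"
      \<comment> \<open>Two equal vectors cancel with coefficients 1 and -1, a nontrivial
        relation.\<close>
      define c :: "'a \<Rightarrow> 'k" where "c = (\<lambda>g. if g = e then 1 else if g = f then - 1 else 0)"
      have "(\<Sum>g\<in>S. c g * v g $ i) = 0" for i
      proof -
        have "(\<Sum>g\<in>S. c g * v g $ i) = (\<Sum>g\<in>{e, f}. c g * v g $ i)"
          using ef finS by (intro sum.mono_neutral_right) (auto simp: c_def)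
        also have "\<dots> = c e * v e $ i + c f * v f $ i"
          using ef(4) by simp
        also have "\<dots> = 0"
          unfolding ef(3) using ef(4) by (simp add: c_def)
        finally show ?thesis .
      qed
      then have "c e = 0" using ind ef unfolding indep_family_def by blast
      then show False by (simp add: c_def)
    qed
    show "lin_indpt (v ` S)"
    proof
      assume "lin_dep (v ` S)"
      then obtain a u where a: "lincomb a (v ` S) = 0\<^sub>v d" "u \<in> v ` S" "a u \<noteq> 0"
        using finite_lin_dep[OF _ _ car] finS by auto
      have "\<forall>i<d. (\<Sum>e\<in>S. a (v e) * v e $ i) = 0"
        using lincomb_eq[OF inj, of _ a] a(1) by auto
      then have "\<forall>e\<in>S. a (v e) = 0"
        using ind[unfolded indep_family_def, rule_format, of "\<lambda>e. a (v e)"] by blast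
      then show False using a by auto
    qed
  qed
qed

lemma indep_family_card_le:
  fixes w :: "'a \<Rightarrow> nat \<Rightarrow> 'k::field"
  assumes "finite S" "indep_family d w S"
  shows "card S \<le> d"
proof -
  interpret vec_space "TYPE('k)" d .
  define v where "v = (\<lambda>e. vec d (w e))"
  have car: "v ` S \<subseteq> carrier_vec d" by (auto simp: v_def)
  have "indep_family d (\<lambda>e i. v e $ i) S"
    using assms(2) by (simp add: indep_family_def v_def)
  then have "inj_on v S" "lin_indpt (v ` S)"
    using indep_family_iff_lin_indpt[OF assms(1) car] by auto
  then show ?thesis
    using li_le_dim(2)[OF fin_dim car] dim_is_n by (simp add: card_image)
qed

text \<open>A relation that kills the powers below \<open>d\<close> kills every polynomial of degree
  below \<open>d\<close>. A polynomial vanishing at all nodes but one then isolates a single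
  coefficient.\<close>

lemma indep_family_vandermonde:
  fixes x :: "'a \<Rightarrow> 'k::field"
  assumes fin: "finite S" and "card S \<le> d" and inj: "inj_on x S"
  shows "indep_family d (\<lambda>e i. x e ^ i) S"
  unfolding indep_family_def
proof (intro allI impI ballI)
  fix c e
  assume c: "\<forall>i<d. (\<Sum>f\<in>S. c f * x f ^ i) = 0" and e: "e \<in> S"
  \<comment> \<open>The Lagrange basis polynomial for the node of \<open>e\<close>, without
    normalisation.\<close>
  define p where "p = (\<Prod>f\<in>S - {e}. [:- x f, 1:])"
  have "degree p \<le> (\<Sum>f\<in>S - {e}. degree [:- x f, 1:])"
    unfolding p_def using fin degree_prod_sum_le[of "S - {e}" "\<lambda>f. [:- x f, 1:]"] by simp
  also have "\<dots> = card S - 1" using fin e by simp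
  finally have deg: "degree p < d"
    using assms(2) e fin card_gt_0_iff[of S] by fastforce
  \<comment> \<open>Expanding \<open>p\<close> into monomials and swapping the sums leaves a
    combination of the vanishing sums in \<open>c\<close>.\<close>
  have "(\<Sum>f\<in>S. c f * poly p (x f)) = (\<Sum>f\<in>S. \<Sum>i\<le>degree p. coeff p i * (c f * x f ^ i))"
    by (simp add: poly_altdef sum_distrib_left mult_ac)
  also have "\<dots> = (\<Sum>i\<le>degree p. coeff p i * (\<Sum>f\<in>S. c f * x f ^ i))"
    by (subst sum.swap) (simp add: sum_distrib_left)
  also have "\<dots> = 0" using c deg by (intro sum.neutral) auto
  finally have "(\<Sum>f\<in>S. c f * poly p (x f)) = 0" .
  moreover have "(\<Sum>f\<in>S. c f * poly p (x f)) = (\<Sum>f\<in>{e}. c f * poly p (x f))"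
    using fin e by (intro sum.mono_neutral_right) (auto simp: p_def poly_prod)
  moreover have "poly p (x e) \<noteq> 0"
    using fin e inj by (auto simp: p_def poly_prod dest: inj_onD)
  ultimately show "c e = 0" by simp
qed

section \<open>Column matroids of truncated matrices and the Vandermonde representation\<close>

lemma column_matroid_first_rows:
  fixes A :: "'k::field mat"
  assumes "finite E" "bij_betw l E {..<dim_col A}"
  shows "column_matroid E l (first_rows d A) =
    \<lparr>ground = E, indeps = {S. S \<subseteq> E \<and> indep_family d (\<lambda>e i. A $$ (i, l e)) S}\<rparr>"
proof -
  have "inj_on (\<lambda>e. col (first_rows d A) (l e)) S \<and>
      \<not> module.lin_dep class_ring (module_vec TYPE('k) (dim_row (first_rows d A)))
        ((\<lambda>e. col (first_rows d A) (l e)) ` S)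
      \<longleftrightarrow> indep_family d (\<lambda>e i. A $$ (i, l e)) S" if S: "S \<subseteq> E" for S
  proof -
    have fin: "finite S" using S assms(1) by (rule finite_subset)
    have entry: "col (first_rows d A) (l e) $ i = A $$ (i, l e)" if "e \<in> S" "i < d" for e i
      using that S bij_betwE[OF assms(2)] by (force simp: first_rows_def)
    have "indep_family d (\<lambda>e i. col (first_rows d A) (l e) $ i) S
        \<longleftrightarrow> indep_family d (\<lambda>e i. A $$ (i, l e)) S"
      unfolding indep_family_def by (simp add: entry cong: sum.cong)
    moreover have dim: "dim_row (first_rows d A) = d" by (simp add: first_rows_def)
    moreover have "(\<lambda>e. col (first_rows d A) (l e)) ` S \<subseteq> carrier_vec d"
      by (intro image_subsetI carrier_vecI) (simp add: dim)
    ultimately show ?thesis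
      using indep_family_iff_lin_indpt[OF fin, of "\<lambda>e. col (first_rows d A) (l e)" d] by simp
  qed
  then show ?thesis unfolding column_matroid_def by auto
qed

lemma length_uniform_indep_flag [simp]: "length (uniform_indep_flag r E) = Suc r"
  by (simp add: uniform_indep_flag_def del: upt_Suc)

lemma nth_uniform_indep_flag:
  "k \<le> r \<Longrightarrow> uniform_indep_flag r E ! k = uniform_matroid k E"
  by (simp add: uniform_indep_flag_def del: upt_Suc)

lemma representable_uniform_indep_flagI:
  fixes x :: "'a \<Rightarrow> 'k::field"
  assumes fin: "finite E" and r: "r \<le> card E" and x: "r \<le> 1 \<or> inj_on x E"
  shows "representable_flag_matroid TYPE('k) E (uniform_indep_flag r E)"
proof -
  obtain l where l: "bij_betw l E {..<card E}"
    using ex_bij_betw_finite_nat[OF fin] by (auto simp: atLeast0LessThan)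
  \<comment> \<open>\<open>inv_into E l\<close> recovers the label of a column. Since
    \<open>0 ^ 0 = 1\<close>, row 0 is constantly 1, even at a zero node.\<close>
  define A :: "'k mat" where "A = mat r (card E) (\<lambda>(i, j). x (inv_into E l j) ^ i)"
  have A: "A \<in> carrier_mat r (card E)" by (simp add: A_def)
  have "uniform_matroid k E = column_matroid E l (first_rows k A)" if k: "k \<le> r" for k
  proof -
    have "indep_family k (\<lambda>e i. A $$ (i, l e)) S \<longleftrightarrow> card S \<le> k" if S: "S \<subseteq> E" for S
    proof -
      have finS: "finite S" using S fin by (rule finite_subset)
      have entry: "A $$ (i, l e) = x e ^ i" if "e \<in> S" "i < k" for e i
        using that S k l bij_betwE[OF l] bij_betw_inv_into_left[OF l]
        by (force simp: A_def)
      have "indep_family k (\<lambda>e i. A $$ (i, l e)) S \<longleftrightarrow> indep_family k (\<lambda>e i. x e ^ i) S"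
        unfolding indep_family_def by (simp add: entry cong: sum.cong)
      \<comment> \<open>For \<open>r \<le> 1\<close> such an \<open>S\<close> has at most one
        element, so any choice of nodes is injective on it.\<close>
      moreover have "inj_on x S" if "card S \<le> k"
      proof (cases "r \<le> 1")
        case True
        then have "card S \<le> 1" using that k by simp
        then show ?thesis using finS by (auto simp: card_le_Suc0_iff_eq inj_on_def)
      next
        case False
        then show ?thesis using x S inj_on_subset by blast
      qed
      ultimately show ?thesis
        using indep_family_card_le[OF finS] indep_family_vandermonde[OF finS] by blast
    qed
    moreover have "bij_betw l E {..<dim_col A}" using l A by simp
    ultimately show ?thesis
      unfolding column_matroid_first_rows[OF fin \<open>bij_betw l E {..<dim_col A}\<close>]
        uniform_matroid_def by auto
  qed
  \<comment> \<open>The row counts are 0, ..., \<open>r\<close>: the matroid of rank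
    \<open>i\<close> uses exactly the first \<open>i\<close> rows.\<close>
  then have "\<forall>i<length (uniform_indep_flag r E).
      uniform_indep_flag r E ! i = column_matroid E l (first_rows ([0..<Suc r] ! i) A)"
    by (simp add: nth_uniform_indep_flag del: upt_Suc)
  moreover have "sorted_wrt (<) [0..<Suc r]" "last [0..<Suc r] = r"
    by (simp_all only: sorted_wrt_upt) simp
  ultimately show ?thesis
    unfolding representable_flag_matroid_def
    using flag_matroid_uniform_indep_flag[OF fin r] A l
    by (intro conjI exI[of _ A] exI[of _ r] exI[of _ l] exI[of _ "[0..<Suc r]"])
      (simp_all del: upt_Suc)
qed

section \<open>Counting points on an affine line\<close>

lemma indep_family_singleton: "indep_family d w {e} \<longleftrightarrow> (\<exists>i<d. w e i \<noteq> 0)"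
proof
  show "\<exists>i<d. w e i \<noteq> 0" if "indep_family d w {e}"
  proof (rule ccontr)
    assume "\<not> (\<exists>i<d. w e i \<noteq> 0)"
    then show False
      using that[unfolded indep_family_def, rule_format, of "\<lambda>_. 1" e] by simp
  qed
qed (auto simp: indep_family_def)

lemma indep_family_pair:
  assumes "e \<noteq> f"
  shows "indep_family d w {e, f} \<longleftrightarrow>
    (\<forall>a b. (\<forall>i<d. a * w e i + b * w f i = 0) \<longrightarrow> a = 0 \<and> b = 0)"
proof
  assume ind: "indep_family d w {e, f}"
  show "\<forall>a b. (\<forall>i<d. a * w e i + b * w f i = 0) \<longrightarrow> a = 0 \<and> b = 0"
  proof (intro allI impI)
    fix a b assume "\<forall>i<d. a * w e i + b * w f i = 0"
    then show "a = 0 \<and> b = 0"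
      using ind[unfolded indep_family_def, rule_format, of "\<lambda>g. if g = e then a else b" e]
        ind[unfolded indep_family_def, rule_format, of "\<lambda>g. if g = e then a else b" f] assms
      by simp
  qed
next
  assume *: "\<forall>a b. (\<forall>i<d. a * w e i + b * w f i = 0) \<longrightarrow> a = 0 \<and> b = 0"
  show "indep_family d w {e, f}"
    unfolding indep_family_def
  proof (intro allI impI)
    fix c assume "\<forall>i<d. (\<Sum>g\<in>{e, f}. c g * w g i) = 0"
    with assms have "\<forall>i<d. c e * w e i + c f * w f i = 0" by simp
    with * have "c e = 0 \<and> c f = 0" by blast
    then show "\<forall>g\<in>{e, f}. c g = 0" by simp
  qed
qed

text \<open>The affine parameter on the line through two scaled columns injects \<open>E\<close>
  into the field. The field is taken finite because \<open>card\<close> of an infinite set is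
  0.\<close>

lemma card_le_if_rank_two_flag:
  fixes w :: "'a \<Rightarrow> nat \<Rightarrow> 'k::field"
  assumes fin: "finite E" and two: "2 \<le> card E" and K: "finite (UNIV :: 'k set)"
    and d: "d1 \<le> d2"
    and one: "\<And>S. S \<subseteq> E \<Longrightarrow> indep_family d1 w S \<longleftrightarrow> card S \<le> 1"
    and two': "\<And>S. S \<subseteq> E \<Longrightarrow> indep_family d2 w S \<longleftrightarrow> card S \<le> 2"
  shows "card E \<le> card (UNIV :: 'k set)"
proof -
  obtain p q where pq: "p \<in> E" "q \<in> E" "p \<noteq> q"
    using two card_le_Suc0_iff_eq[OF fin] by fastforce
  have "indep_family d1 w {p}" using one[of "{p}"] pq by simp
  then obtain k where k: "k < d1" "w p k \<noteq> 0"
    unfolding indep_family_singleton by blast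
  \<comment> \<open>Within the first \<open>d1\<close> rows all columns are nonzero and pairwise
    proportional, so they share their support; the coordinate \<open>k\<close>, nonzero for
    \<open>p\<close>, is nonzero for all.\<close>
  have nz: "w e k \<noteq> 0" if e: "e \<in> E" for e
  proof (cases "e = p")
    case False
    then have "\<not> indep_family d1 w {p, e}" using one[of "{p, e}"] pq e by simp
    then obtain a b where ab: "\<forall>i<d1. a * w p i + b * w e i = 0" "a \<noteq> 0 \<or> b \<noteq> 0"
      using indep_family_pair[of p e d1 w] False by blast
    have "indep_family d1 w {e}" using one[of "{e}"] e by simp
    then obtain i where i: "i < d1" "w e i \<noteq> 0"
      unfolding indep_family_singleton by blast
    have "a \<noteq> 0" using ab(1)[rule_format, OF i(1)] ab(2) i(2) by auto
    then show ?thesis using ab(1)[rule_format, OF k(1)] k(2) by auto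
  qed (use k in simp)
  have k2: "k < d2" using k d by simp
  have indpq: "\<forall>a b. (\<forall>i<d2. a * w p i + b * w q i = 0) \<longrightarrow> a = 0 \<and> b = 0"
    unfolding indep_family_pair[OF pq(3), symmetric] using two'[of "{p, q}"] pq by simp
  define u where "u e i = w e i / w e k" for e i
  have "\<exists>a. \<forall>i<d2. u e i = a * u p i + (1 - a) * u q i" if e: "e \<in> E" for e
  proof -
    \<comment> \<open>Rank two: \<open>p\<close> and \<open>q\<close> are independent, so they span
      every other column.\<close>
    have "\<exists>a b. \<forall>i<d2. w e i = a * w p i + b * w q i"
    proof (cases "e = p \<or> e = q")
      case True
      then show ?thesis
      proof
        assume "e = p" then show ?thesis by (intro exI[of _ 1] exI[of _ 0]) simp
      next
        assume "e = q" then show ?thesis by (intro exI[of _ 0] exI[of _ 1]) simp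
      qed
    next
      case False
      then have "card {p, q, e} = 3" using pq by auto
      then have "\<not> indep_family d2 w {p, q, e}" using two'[of "{p, q, e}"] pq e by simp
      then obtain c where c: "\<forall>i<d2. c p * w p i + c q * w q i + c e * w e i = 0"
          "c p \<noteq> 0 \<or> c q \<noteq> 0 \<or> c e \<noteq> 0"
        using False pq unfolding indep_family_def by (auto simp: add.assoc)
      have ce: "c e \<noteq> 0"
      proof
        assume "c e = 0"
        with c(1) have "\<forall>i<d2. c p * w p i + c q * w q i = 0" by simp
        then have "c p = 0 \<and> c q = 0" using indpq by blast
        with c(2) \<open>c e = 0\<close> show False by simp
      qed
      have "w e i = - (c p / c e) * w p i + - (c q / c e) * w q i" if "i < d2" for i
      proof -
        have "c e * w e i = - (c p * w p i + c q * w q i)"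
          using minus_unique[OF c(1)[rule_format, OF that]] by simp
        then show ?thesis using ce by (simp add: field_simps)
      qed
      then show ?thesis by blast
    qed
    then obtain a b where ab: "\<forall>i<d2. w e i = a * w p i + b * w q i" by blast
    \<comment> \<open>The coefficient of \<open>p\<close> after scaling. As all scaled columns have
      entry 1 at \<open>k\<close>, comparing that coordinate forces the two coefficients to sum to
      1.\<close>
    define a' where "a' = a * w p k / w e k"
    have "1 - a' = b * w q k / w e k"
      using ab[rule_format, OF k2] nz[OF e] by (simp add: a'_def field_simps)
    then have "u e i = a' * u p i + (1 - a') * u q i" if "i < d2" for i
      using ab that nz[OF e] nz[OF pq(1)] nz[OF pq(2)]
      by (simp add: u_def a'_def add_divide_distrib)
    then show ?thesis by blast
  qed
  then obtain \<phi> where \<phi>: "\<And>e i. e \<in> E \<Longrightarrow> i < d2 \<Longrightarrow> u e i = \<phi> e * u p i + (1 - \<phi> e) * u q i"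
    by metis
  have "inj_on \<phi> E"
  proof (rule inj_onI, rule ccontr)
    fix e f assume ef: "e \<in> E" "f \<in> E" "\<phi> e = \<phi> f" "e \<noteq> f"
    \<comment> \<open>Equal parameters give equal scaled columns; clearing denominators yields a
      relation whose coefficients are nonzero by \<open>nz\<close>.\<close>
    have "w f k * w e i + - w e k * w f i = 0" if "i < d2" for i
    proof -
      have "u e i = u f i" using \<phi>[of e i] \<phi>[of f i] ef that by simp
      then show ?thesis using nz[OF ef(1)] nz[OF ef(2)] by (simp add: u_def field_simps)
    qed
    moreover have "indep_family d2 w {e, f}" using two'[of "{e, f}"] ef by simp
    ultimately have "w f k = 0"
      unfolding indep_family_pair[OF ef(4)] by blast
    then show False using nz ef by blast
  qed
  then show ?thesis using K by (intro card_inj_on_le[of \<phi>]) auto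
qed

section \<open>The equivalence, with finite and infinite fields treated separately\<close>

theorem theorem3p10:
  fixes E :: "'a set" and r n :: nat
  assumes "finite E" and "card E = n" and "r \<le> n"
  shows "representable_flag_matroid TYPE('k::field) E (uniform_indep_flag r E) \<longleftrightarrow>
           r \<le> 1 \<or> infinite (UNIV :: 'k set) \<or> n \<le> card (UNIV :: 'k set)"
proof
  assume rep: "representable_flag_matroid TYPE('k) E (uniform_indep_flag r E)"
  show "r \<le> 1 \<or> infinite (UNIV :: 'k set) \<or> n \<le> card (UNIV :: 'k set)"
  proof (rule ccontr)
    assume neg: "\<not> ?thesis"
    then have r: "2 \<le> r" and K: "finite (UNIV :: 'k set)" by auto
    obtain A :: "'k mat" and m l ds where A: "A \<in> carrier_mat m (card E)"
      and l: "bij_betw l E {..<card E}" and ds: "length ds = Suc r" "sorted_wrt (<) ds"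
      and eq: "\<And>i. i \<le> r \<Longrightarrow> uniform_matroid i E = column_matroid E l (first_rows (ds ! i) A)"
      using rep unfolding representable_flag_matroid_def
      by (auto simp: less_Suc_eq_le nth_uniform_indep_flag)
    define w where "w e i = A $$ (i, l e)" for e i
    have "bij_betw l E {..<dim_col A}" using l A by simp
    note cm = column_matroid_first_rows[OF assms(1) this]
    have "indep_family (ds ! i) w S \<longleftrightarrow> card S \<le> i" if "i \<le> r" "S \<subseteq> E" for i S
    proof -
      have "{S. S \<subseteq> E \<and> card S \<le> i} = {S. S \<subseteq> E \<and> indep_family (ds ! i) w S}"
        using eq[OF that(1)] unfolding cm uniform_matroid_def w_def by simp
      then show ?thesis using that(2) by blast
    qed
    \<comment> \<open>Positions 1 and 2, counted from 0, hold the matroids of rank 1 and 2. The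
      inequality keeps the scaling row inside the larger truncation.\<close>
    moreover have "ds ! 1 \<le> ds ! 2"
      using sorted_wrt_nth_less[OF ds(2), of 1 2] ds(1) r by simp
    ultimately have "card E \<le> card (UNIV :: 'k set)"
      using card_le_if_rank_two_flag[OF assms(1) _ K, of "ds ! 1" "ds ! 2" w] r assms by simp
    then show False using neg assms by simp
  qed
next
  assume "r \<le> 1 \<or> infinite (UNIV :: 'k set) \<or> n \<le> card (UNIV :: 'k set)"
  \<comment> \<open>Distinct nodes come from a subset of the field with as many elements as
    \<open>E\<close>; for \<open>r \<le> 1\<close> any \<open>x\<close> serves.\<close>
  then obtain x :: "'a \<Rightarrow> 'k" where "r \<le> 1 \<or> inj_on x E"
  proof (elim disjE)
    assume "infinite (UNIV :: 'k set)"
    then obtain B :: "'k set" where "finite B" "card B = card E"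
      using infinite_arbitrarily_large by blast
    then show ?thesis
      using that finite_same_card_bij[OF assms(1)] by (metis bij_betw_imp_inj_on)
  next
    assume le: "n \<le> card (UNIV :: 'k set)"
    then obtain B :: "'k set" where B: "card B = n" "finite B"
      using obtain_subset_with_card_n by metis
    then show ?thesis
      using that finite_same_card_bij[OF assms(1)] assms(2) by (metis bij_betw_imp_inj_on)
  qed (use that in blast)
  then show "representable_flag_matroid TYPE('k) E (uniform_indep_flag r E)"
    using representable_uniform_indep_flagI assms by blast
qed

end
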